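(* For each $n$, let $X_{(1)}\le\cdots\le X_{(n)}$ be the order statistics of the first $n$ terms of an i.i.d. sequence of unit exponential random variables, and let $Y_{(1)}\le\cdots\le Y_{(n)}$ be the order statistics of the first $n$ terms of an independent i.i.d. sequence of positive random variables with a monotone increasing, continuous distribution function. Let $$\alpha_n=\sqrt{\frac{\log n\,\log\log n}{n}},\qquad \beta_n=1-\alpha_n,\qquad \Lambda_m=\{i\in\mathbb{N}:\alpha_n n<i<\beta_n n\}.$$ Then $$\max_{i\in\Lambda_m}\frac{X_{(i)}}{Y_{(i)}}\xrightarrow{P}1\quad\text{and}\quad \max_{i\in\Lambda_m}\frac{Y_{(i)}}{X_{(i)}}\xrightarrow{P}1\qquad(n\to\infty)$$ both hold if and only if the common distribution of the second sequence (that of the $Y$'s) is the unit exponential distribution.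
   Context: A unit exponential random variable has distribution function $1-e^{-x}$, $x\ge 0$. $\xrightarrow{P}$ denotes convergence in probability. All quantities are considered for $n$ large enough that $\alpha_n<\beta_n$ and $\Lambda_m$ is nonempty. "Monotone increasing" is understood on the support (in the positive half-line) of the distribution. The subscript $m$ in $\Lambda_m$ stands for "middle" and is not an index. *)

theory Defs
  imports "HOL-Probability.Probability"
begin

definition unit_exponential :: "real measure" where
  "unit_exponential = density lborel (\<lambda>x. ennreal (exponential_density 1 x))"

text \<open>Sanity check: this is the law with distribution function \<^term>\<open>1 - exp (- x)\<close> on the
  positive half-line.\<close>

lemma cdf_unit_exponential:
  assumes "0 \<le> x"
  shows "cdf unit_exponential x = 1 - exp (- x)"
proof -
  have "emeasure unit_exponential {..x} = ennreal (erlang_CDF 0 1 x)"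
    unfolding unit_exponential_def using emeasure_erlang_density[of 1 0 x] by simp
  also have "erlang_CDF 0 1 x = 1 - exp (- x)"
    using assms by (simp add: erlang_CDF_def)
  finally show ?thesis
    using assms by (simp add: cdf_def measure_def)
qed

definition measure_support :: "real measure \<Rightarrow> real set" where
  "measure_support D = {x. \<forall>e>0. measure D (ball x e) > 0}"

context prob_space
begin

text \<open>Measurability of each \<open>Z i\<close> is part of \<^const>\<open>indep_vars\<close>.\<close>

definition iid_seq :: "(nat \<Rightarrow> 'a \<Rightarrow> real) \<Rightarrow> real measure \<Rightarrow> bool" where
  "iid_seq Z D \<longleftrightarrow> indep_vars (\<lambda>_. borel) Z UNIV \<and> (\<forall>i. distr M borel (Z i) = D)"

definition indep_seqs :: "(nat \<Rightarrow> 'a \<Rightarrow> real) \<Rightarrow> (nat \<Rightarrow> 'a \<Rightarrow> real) \<Rightarrow> bool" where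
  "indep_seqs X Y \<longleftrightarrow>
     indep_var (\<Pi>\<^sub>M i\<in>UNIV. borel) (\<lambda>\<omega> i. X i \<omega>) (\<Pi>\<^sub>M i\<in>UNIV. borel) (\<lambda>\<omega> i. Y i \<omega>)"

definition conv_in_prob :: "(nat \<Rightarrow> 'a \<Rightarrow> real) \<Rightarrow> real \<Rightarrow> bool" where
  "conv_in_prob Z c \<longleftrightarrow>
     (\<forall>\<epsilon>>0. (\<lambda>n. prob {\<omega> \<in> space M. \<bar>Z n \<omega> - c\<bar> > \<epsilon>}) \<longlonglongrightarrow> 0)"

end

text \<open>The sequence is indexed from 0, so its first \<open>n\<close> terms are \<open>Z 0, \<dots>, Z (n - 1)\<close>; the rank
  \<open>i\<close> runs over \<open>1, \<dots>, n\<close>, rank 1 being the minimum. Other ranks carry no meaning.\<close>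

definition order_stat :: "(nat \<Rightarrow> 'a \<Rightarrow> real) \<Rightarrow> nat \<Rightarrow> nat \<Rightarrow> 'a \<Rightarrow> real" where
  "order_stat Z n i \<omega> = sort (map (\<lambda>j. Z j \<omega>) [0..<n]) ! (i - 1)"

definition alpha :: "nat \<Rightarrow> real" where
  "alpha n = sqrt (ln (real n) * ln (ln (real n)) / real n)"

definition beta :: "nat \<Rightarrow> real" where
  "beta n = 1 - alpha n"

definition middle_ranks :: "nat \<Rightarrow> nat set" where
  "middle_ranks n = {i. alpha n * real n < real i \<and> real i < beta n * real n}"

text \<open>For small \<open>n\<close> the set \<^term>\<open>middle_ranks n\<close> may be empty or contain ranks outside
  \<open>1, \<dots>, n\<close>, and then the value below is arbitrary; this happens for finitely many \<open>n\<close> only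
  and does not affect limits.\<close>

definition max_ratio :: "(nat \<Rightarrow> 'a \<Rightarrow> real) \<Rightarrow> (nat \<Rightarrow> 'a \<Rightarrow> real) \<Rightarrow> nat \<Rightarrow> 'a \<Rightarrow> real" where
  "max_ratio X Y n \<omega> = Max ((\<lambda>i. order_stat X n i \<omega> / order_stat Y n i \<omega>) ` middle_ranks n)"

end

theory Submission
  imports Defs "HOL-Real_Asymp.Real_Asymp"
begin

text \<open>
  Everything rests on one exponential bound. The event that the \<open>i\<close>-th order statistic is at most
  \<open>t\<close> says that at least \<open>i\<close> of the \<open>n\<close> sample points lie in \<open>{..t}\<close>, so it is a statement
  about a sum of \<open>n\<close> independent indicators with mean \<open>F t\<close>. Hoeffding's inequality then gives
  probability at most \<open>exp (- 2 n s\<^sup>2)\<close> to the event that the order statistic lies on the wrong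
  side of \<open>t\<close> when \<open>i / n\<close> and \<open>F t\<close> differ by at least \<open>s\<close>
  (\<open>prob_order_stat_le\<close>, \<open>prob_order_stat_gt\<close>).

  Two exponential samples. Take \<open>s = \<delta> = sqrt (ln n / n)\<close>. Each bad event has probability at most
  \<open>n\<^sup>-\<^sup>2\<close>, so a union bound over at most \<open>n\<close> ranks leaves \<open>O(1 / n)\<close>: apart from such an event, for
  every middle rank with \<open>p = i / n\<close> both order statistics lie between the quantiles
  \<open>Q(p - \<delta>)\<close> and \<open>Q(p + \<delta>)\<close>, where \<open>Q(u) = - ln (1 - u)\<close>. The middle ranks keep \<open>p\<close> and \<open>1 - p\<close>
  above \<open>\<alpha>\<^sub>n = \<delta> * sqrt (ln (ln n))\<close>, so \<open>\<delta>\<close> is negligible against both, and the two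
  quantiles then have ratio close to 1 uniformly in \<open>p\<close> (\<open>exponential_quantile_ratio\<close>).

  Converse. A bound on the maximal ratio \<open>A / B\<close> is an order relation between the laws: if the
  distribution function of \<open>A\<close> at \<open>u\<close> were below that of \<open>B\<close> at some \<open>t < u\<close>, then at a level \<open>p\<close>
  strictly between the two values the \<open>p\<close>-quantile of the \<open>A\<close> sample would exceed \<open>u\<close> and that of
  the \<open>B\<close> sample would be at most \<open>t\<close>, which forces a ratio above \<open>u / t > 1\<close>
  (\<open>cdf_le_if_max_ratio_conv\<close>). Both ratios together make the distribution functions agree.
\<close>

section \<open>Order statistics\<close>

lemma sorted_nth_le_iff:
  fixes xs :: "'b::linorder list"
  assumes "sorted xs" "k < length xs"
  shows "xs ! k \<le> t \<longleftrightarrow> k < length (filter (\<lambda>x. x \<le> t) xs)"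
  using assms
proof (induction xs arbitrary: k)
  case (Cons x xs)
  show ?case
  proof (cases "x \<le> t")
    case True
    with Cons show ?thesis by (cases k) auto
  next
    case False
    hence "\<forall>y\<in>set (x # xs). \<not> y \<le> t" using Cons.prems by auto
    moreover from this have "filter (\<lambda>x. x \<le> t) (x # xs) = []"
      by (simp only: filter_False)
    ultimately show ?thesis using Cons.prems nth_mem by (metis list.size(3) not_less_zero)
  qed
qed simp

lemma order_stat_le_iff:
  assumes "1 \<le> i" "i \<le> n"
  shows "order_stat Z n i \<omega> \<le> t \<longleftrightarrow> i \<le> card {j\<in>{..<n}. Z j \<omega> \<le> t}"
proof -
  let ?xs = "map (\<lambda>j. Z j \<omega>) [0..<n]"
  have "mset (filter (\<lambda>x. x \<le> t) (sort ?xs)) = mset (filter (\<lambda>x. x \<le> t) ?xs)"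
    by (simp del: mset_map)
  hence "length (filter (\<lambda>x. x \<le> t) (sort ?xs)) = length (filter (\<lambda>x. x \<le> t) ?xs)"
    by (rule mset_eq_length)
  also have "\<dots> = card {j\<in>{..<n}. Z j \<omega> \<le> t}"
    by (auto simp: length_filter_conv_card intro!: arg_cong[where f = card])
  finally have "length (filter (\<lambda>x. x \<le> t) (sort ?xs)) = card {j\<in>{..<n}. Z j \<omega> \<le> t}" .
  thus ?thesis
    using sorted_nth_le_iff[of "sort ?xs" "i - 1" t] assms
    by (auto simp: order_stat_def)
qed

text \<open>The counting form above, written as a sum of indicators so that concentration inequalities for
  sums apply to order statistics.\<close>

lemma order_stat_le_iff_sum:
  assumes "1 \<le> i" "i \<le> n"
  shows "order_stat Z n i \<omega> \<le> t \<longleftrightarrow> real i \<le> (\<Sum>j<n. indicator {..t} (Z j \<omega>))"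
proof -
  have "(\<Sum>j<n. indicator {..t} (Z j \<omega>)) = real (card ({..<n} \<inter> {j. Z j \<omega> \<le> t}))"
    by (simp add: indicator_def sum.If_cases)
  also have "{..<n} \<inter> {j. Z j \<omega> \<le> t} = {j\<in>{..<n}. Z j \<omega> \<le> t}" by auto
  finally show ?thesis using order_stat_le_iff[OF assms, of Z \<omega> t] by simp
qed

lemma measurable_order_stat:
  assumes "1 \<le> i" "i \<le> n" and [measurable]: "\<And>j. Z j \<in> borel_measurable M"
  shows "order_stat Z n i \<in> borel_measurable M"
proof (subst borel_measurable_iff_le, rule allI)
  fix t
  show "{\<omega> \<in> space M. order_stat Z n i \<omega> \<le> t} \<in> sets M"
    unfolding order_stat_le_iff_sum[OF assms(1,2)] by measurable
qed

section \<open>Concentration of order statistics\<close>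

context prob_space
begin

lemma iid_seq_measurable: "iid_seq Z D \<Longrightarrow> Z j \<in> borel_measurable M"
  by (auto simp: iid_seq_def indep_vars_def)

lemma iid_seq_real_distribution: "iid_seq Z D \<Longrightarrow> real_distribution D"
  by (metis iid_seq_def iid_seq_measurable real_distribution_distr)

lemma iid_seq_cdf:
  assumes "iid_seq Z D"
  shows "cdf D t = prob {\<omega> \<in> space M. Z j \<omega> \<le> t}"
proof -
  have [measurable]: "Z j \<in> borel_measurable M" using assms by (rule iid_seq_measurable)
  have "cdf D t = measure (distr M borel (Z j)) {..t}"
    using assms by (simp add: iid_seq_def cdf_def)
  also have "\<dots> = prob {\<omega> \<in> space M. Z j \<omega> \<le> t}"
    by (subst measure_distr) (auto intro!: arg_cong[where f = prob])
  finally show ?thesis .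
qed

lemma iid_bounded_indicator:
  assumes "iid_seq Z D"
  shows "iid_interval_bounded_random_variables M {..<n} (\<lambda>j \<omega>. indicator {..t} (Z j \<omega>))
           (\<lambda>\<omega>. indicator {..t} (Z 0 \<omega>)) 0 1"
proof unfold_locales
  note [measurable] = iid_seq_measurable[OF assms(1)]
  have "indep_vars (\<lambda>_. borel) Z {..<n}"
    using assms(1) unfolding iid_seq_def by (blast intro: indep_vars_subset)
  thus "indep_vars (\<lambda>_. borel) (\<lambda>j \<omega>. indicator {..t} (Z j \<omega>) :: real) {..<n}"
    by (rule indep_vars_compose2) measurable
  have *: "distr M borel (\<lambda>\<omega>. indicator {..t} (Z j \<omega>) :: real) = distr D borel (indicator {..t})" for j
  proof -
    have "distr D borel (indicator {..t} :: real \<Rightarrow> real) =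
            distr (distr M borel (Z j)) borel (indicator {..t})"
      using assms(1) by (simp add: iid_seq_def)
    also have "\<dots> = distr M borel (\<lambda>\<omega>. indicator {..t} (Z j \<omega>))"
      by (subst distr_distr) (auto simp: o_def)
    finally show ?thesis by simp
  qed
  show "distr M borel (\<lambda>\<omega>. indicator {..t} (Z j \<omega>) :: real) =
          distr M borel (\<lambda>\<omega>. indicator {..t} (Z 0 \<omega>))" if "j \<in> {..<n}" for j
    by (simp only: *)
  show "(\<lambda>\<omega>. indicator {..t} (Z 0 \<omega>) :: real) \<in> borel_measurable M" by measurable
qed (auto simp: indicator_def)

lemma expectation_indicator_iid:
  assumes "iid_seq Z D"
  shows "expectation (\<lambda>\<omega>. indicator {..t} (Z 0 \<omega>) :: real) = cdf D t"
proof -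
  note [measurable] = iid_seq_measurable[OF assms(1)]
  have "expectation (\<lambda>\<omega>. indicator {..t} (Z 0 \<omega>) :: real) =
          expectation (indicator {\<omega>\<in>space M. Z 0 \<omega> \<le> t})"
    by (intro Bochner_Integration.integral_cong) (auto simp: indicator_def)
  also have "\<dots> = cdf D t"
    by (simp add: iid_seq_cdf[OF assms, of t 0])
  finally show ?thesis .
qed

text \<open>If the order statistic of relative rank \<open>i / n \<ge> F t + s\<close> is at most \<open>t\<close>, then the empirical
  distribution function at \<open>t\<close> overshoots its mean \<open>F t\<close> by at least \<open>s\<close>.\<close>

lemma prob_order_stat_le:
  assumes "iid_seq Z D" "1 \<le> i" "i \<le> n" "0 \<le> s" "cdf D t + s \<le> real i / real n"
  shows "prob {\<omega>\<in>space M. order_stat Z n i \<omega> \<le> t} \<le> exp (- 2 * real n * s\<^sup>2)"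
proof -
  note [measurable] = iid_seq_measurable[OF assms(1)]
  have n: "0 < n" using assms by simp
  interpret H: iid_interval_bounded_random_variables M "{..<n}" "\<lambda>j \<omega>. indicator {..t} (Z j \<omega>)"
    "\<lambda>\<omega>. indicator {..t} (Z 0 \<omega>)" 0 1
    using iid_bounded_indicator[OF assms(1)] .
  interpret H: Hoeffding_ineq_iid M "{..<n}" "\<lambda>j \<omega>. indicator {..t} (Z j \<omega>)"
    "\<lambda>\<omega>. indicator {..t} (Z 0 \<omega>)" 0 1 "cdf D t"
    by unfold_locales (simp add: expectation_indicator_iid[OF assms(1)])
  have "prob {\<omega>\<in>space M. order_stat Z n i \<omega> \<le> t} \<le>
      prob {\<omega>\<in>space M. (\<Sum>j<n. indicator {..t} (Z j \<omega>)) / real n \<ge> cdf D t + s}"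
  proof (rule finite_measure_mono)
    show "{\<omega>\<in>space M. order_stat Z n i \<omega> \<le> t} \<subseteq>
      {\<omega>\<in>space M. (\<Sum>j<n. indicator {..t} (Z j \<omega>)) / real n \<ge> cdf D t + s}"
    proof safe
      fix \<omega> assume "order_stat Z n i \<omega> \<le> t"
      hence "real i / real n \<le> (\<Sum>j<n. indicator {..t} (Z j \<omega>)) / real n"
        using order_stat_le_iff_sum[OF assms(2,3), of Z \<omega> t] by (intro divide_right_mono) auto
      thus "cdf D t + s \<le> (\<Sum>j<n. indicator {..t} (Z j \<omega>)) / real n" using assms(5) by linarith
    qed
  qed measurable
  also have "\<dots> \<le> exp (- 2 * real n * s\<^sup>2)"
    using H.Hoeffding_ineq_ge'[OF assms(4)] n by (simp add: lessThan_empty_iff)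
  finally show ?thesis .
qed

lemma prob_order_stat_gt:
  assumes "iid_seq Z D" "1 \<le> i" "i \<le> n" "0 \<le> s" "real i / real n \<le> cdf D t - s"
  shows "prob {\<omega>\<in>space M. t < order_stat Z n i \<omega>} \<le> exp (- 2 * real n * s\<^sup>2)"
proof -
  note [measurable] = iid_seq_measurable[OF assms(1)]
  have n: "0 < n" using assms by simp
  interpret H: iid_interval_bounded_random_variables M "{..<n}" "\<lambda>j \<omega>. indicator {..t} (Z j \<omega>)"
    "\<lambda>\<omega>. indicator {..t} (Z 0 \<omega>)" 0 1
    using iid_bounded_indicator[OF assms(1)] .
  interpret H: Hoeffding_ineq_iid M "{..<n}" "\<lambda>j \<omega>. indicator {..t} (Z j \<omega>)"
    "\<lambda>\<omega>. indicator {..t} (Z 0 \<omega>)" 0 1 "cdf D t"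
    by unfold_locales (simp add: expectation_indicator_iid[OF assms(1)])
  have "prob {\<omega>\<in>space M. t < order_stat Z n i \<omega>} \<le>
      prob {\<omega>\<in>space M. (\<Sum>j<n. indicator {..t} (Z j \<omega>)) / real n \<le> cdf D t - s}"
  proof (rule finite_measure_mono)
    show "{\<omega>\<in>space M. t < order_stat Z n i \<omega>} \<subseteq>
      {\<omega>\<in>space M. (\<Sum>j<n. indicator {..t} (Z j \<omega>)) / real n \<le> cdf D t - s}"
    proof safe
      fix \<omega> assume "t < order_stat Z n i \<omega>"
      hence "(\<Sum>j<n. indicator {..t} (Z j \<omega>)) / real n \<le> real i / real n"
        using order_stat_le_iff_sum[OF assms(2,3), of Z \<omega> t] by (intro divide_right_mono) auto
      thus "(\<Sum>j<n. indicator {..t} (Z j \<omega>)) / real n \<le> cdf D t - s" using assms(5) by linarith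
    qed
  qed measurable
  also have "\<dots> \<le> exp (- 2 * real n * s\<^sup>2)"
    using H.Hoeffding_ineq_le'[OF assms(4)] n by (simp add: lessThan_empty_iff)
  finally show ?thesis .
qed

end

section \<open>The middle ranks\<close>

lemma alpha_tendsto_0: "alpha \<longlonglongrightarrow> 0"
  unfolding alpha_def by real_asymp

lemma alpha_pos: "eventually (\<lambda>n. 0 < alpha n) sequentially"
  unfolding alpha_def by real_asymp

text \<open>The factor \<open>ln (ln n)\<close> in \<^const>\<open>alpha\<close> makes the sampling error \<open>sqrt (ln n / n)\<close>, which is what
  a union bound over \<open>n\<close> ranks costs, of smaller order than the distance of the middle
  ranks from the ends.\<close>

lemma sqrt_ln_div_le_alpha:
  assumes "0 < \<eta>"
  shows "eventually (\<lambda>n. sqrt (ln (real n) / real n) \<le> \<eta> * alpha n) sequentially"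
proof -
  have "filterlim (\<lambda>n::nat. ln (ln (real n))) at_top sequentially"
    by real_asymp
  hence "eventually (\<lambda>n::nat. 1 / \<eta>\<^sup>2 \<le> ln (ln (real n))) sequentially"
    by (simp add: filterlim_at_top)
  hence "eventually (\<lambda>n::nat. 1 / \<eta>\<^sup>2 \<le> ln (ln (real n)) \<and> 1 \<le> n) sequentially"
    using eventually_ge_at_top[of 1] by eventually_elim auto
  thus ?thesis
  proof eventually_elim
    case (elim n)
    have "1 \<le> \<eta>\<^sup>2 * ln (ln (real n))" using elim assms by (simp add: field_simps)
    hence "ln (real n) / real n * 1 \<le> ln (real n) / real n * (\<eta>\<^sup>2 * ln (ln (real n)))"
      using elim by (intro mult_left_mono) auto
    hence "sqrt (ln (real n) / real n) \<le> sqrt (\<eta>\<^sup>2 * (ln (real n) * ln (ln (real n)) / real n))"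
      by (simp add: field_simps)
    also have "\<dots> = \<eta> * alpha n"
      using assms by (simp only: alpha_def real_sqrt_mult[of "\<eta>\<^sup>2"] times_divide_eq_right[symmetric]) simp
    finally show ?case .
  qed
qed

lemma middle_ranks_subset:
  assumes "0 < alpha n"
  shows "middle_ranks n \<subseteq> {1..<n}"
proof
  fix i assume i: "i \<in> middle_ranks n"
  have "0 \<le> alpha n * real n" using assms by simp
  with i have "0 < real i" "real i < real n"
    by (auto simp: middle_ranks_def beta_def algebra_simps)
  thus "i \<in> {1..<n}" by auto
qed

lemma nat_ceiling_in_middle_ranks:
  assumes "0 < p" "p < 1"
  shows "eventually (\<lambda>n. nat \<lceil>real n * p\<rceil> \<in> middle_ranks n) sequentially"
proof -
  have "eventually (\<lambda>n. alpha n < min p ((1 - p) / 2)) sequentially"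
    using alpha_tendsto_0 assms by (intro order_tendstoD) auto
  moreover have "eventually (\<lambda>n::nat. 2 / (1 - p) < real n) sequentially"
    using filterlim_real_sequentially by (simp add: filterlim_at_top_dense)
  ultimately show ?thesis
  proof eventually_elim
    case (elim n)
    have n: "0 < real n" using elim assms by (meson divide_pos_pos diff_gt_0_iff_gt less_trans zero_less_numeral)
    have "alpha n * real n < p * real n" using elim n by (intro mult_strict_right_mono) auto
    moreover have "alpha n * real n < (1 - p) / 2 * real n"
      using elim n by (intro mult_strict_right_mono) auto
    moreover have "1 < (1 - p) / 2 * real n" using elim assms by (simp add: field_simps)
    moreover have "real n * p \<le> real (nat \<lceil>real n * p\<rceil>)" "real (nat \<lceil>real n * p\<rceil>) < real n * p + 1"
      using assms n by linarith (use assms n in \<open>simp add: ceiling_less_iff\<close>; linarith)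
    ultimately have "alpha n * real n < real (nat \<lceil>real n * p\<rceil>)"
      "real (nat \<lceil>real n * p\<rceil>) < real n - alpha n * real n"
      by (simp_all only: left_diff_distrib diff_divide_distrib mult.commute[of "real n" p])
    thus ?case by (simp add: middle_ranks_def beta_def left_diff_distrib)
  qed
qed

lemma middle_ranks_nonempty: "eventually (\<lambda>n. middle_ranks n \<noteq> {}) sequentially"
  using nat_ceiling_in_middle_ranks[of "1/2"] by (auto elim!: eventually_mono)

section \<open>Ratio convergence orders the distribution functions\<close>

context prob_space
begin

lemma measurable_max_ratio:
  assumes "iid_seq A D" "iid_seq B E" "0 < alpha n" "middle_ranks n \<noteq> {}"
  shows "max_ratio A B n \<in> borel_measurable M"
proof -
  have "finite (middle_ranks n)" using middle_ranks_subset[OF assms(3)] finite_subset by blast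
  moreover have "order_stat A n i \<in> borel_measurable M" "order_stat B n i \<in> borel_measurable M"
    if "i \<in> middle_ranks n" for i
    using that middle_ranks_subset[OF assms(3)] iid_seq_measurable[OF assms(1)] iid_seq_measurable[OF assms(2)]
    by (force intro!: measurable_order_stat)+
  ultimately have "(\<lambda>\<omega>. Max ((\<lambda>i. order_stat A n i \<omega> / order_stat B n i \<omega>) ` middle_ranks n)) \<in> borel_measurable M"
    by (intro borel_measurable_Max borel_measurable_divide) auto
  thus ?thesis by (simp add: max_ratio_def[abs_def])
qed

text \<open>An empirical quantile of \<open>A\<close> above \<open>u\<close> over one of \<open>B\<close> in \<open>{0<..t}\<close> gives a ratio above
  \<open>u / t\<close>. The gap between \<open>t\<close> and \<open>u\<close> leaves room for the tolerance \<open>\<epsilon>\<close> of the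
  convergence. The condition at 0 keeps the denominators positive: a negative denominator would let
  a large numerator pass under the maximum unnoticed.\<close>

lemma cdf_le_if_max_ratio_conv:
  assumes A: "iid_seq A D" and B: "iid_seq B E" and E0: "cdf E 0 = 0"
    and conv: "conv_in_prob (max_ratio A B) 1" and tu: "t < u"
  shows "cdf E t \<le> cdf D u"
proof (rule ccontr)
  interpret D: real_distribution D using A by (rule iid_seq_real_distribution)
  interpret E: real_distribution E using B by (rule iid_seq_real_distribution)
  assume "\<not> cdf E t \<le> cdf D u"
  hence lt: "cdf D u < cdf E t" by simp
  have t: "0 < t"
  proof (rule ccontr)
    assume "\<not> 0 < t"
    hence "cdf E t \<le> 0" using E.cdf_nondecreasing[of t 0] E0 by simp
    thus False using lt D.cdf_nonneg[of u] by linarith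
  qed
  \<comment> \<open>\<open>p\<close> is the midpoint of the gap; \<open>s\<close> is a quarter of the gap, so that rounding \<open>n p\<close> up to a
    rank, which costs \<open>1 / n \<le> s\<close>, still leaves a margin \<open>s\<close> on the side of \<open>B\<close>.\<close>
  define p where "p = (cdf D u + cdf E t) / 2"
  define s where "s = (cdf E t - cdf D u) / 4"
  have s: "0 < s" using lt by (simp add: s_def)
  have ps: "p - s \<ge> cdf D u" "p + 2 * s = cdf E t" using lt by (auto simp: p_def s_def field_simps)
  have p: "0 < p" "p < 1"
    using lt D.cdf_nonneg[of u] E.cdf_bounded_prob[of t] by (auto simp: p_def)
  define \<epsilon> where "\<epsilon> = u / t - 1"
  have \<epsilon>: "0 < \<epsilon>" using t tu by (simp add: \<epsilon>_def)
  define i where "i n = nat \<lceil>real n * p\<rceil>" for n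
  define P where "P n = prob {\<omega>\<in>space M. \<bar>max_ratio A B n \<omega> - 1\<bar> > \<epsilon>}" for n
  have P: "P \<longlonglongrightarrow> 0" using conv \<epsilon> by (auto simp: P_def[abs_def] conv_in_prob_def)
  \<comment> \<open>For large \<open>n\<close> four events of vanishing probability cover the whole space.\<close>
  have "eventually (\<lambda>n. 1 \<le> P n + 2 * exp (- 2 * real n * s\<^sup>2) + exp (- 2 * real n * p\<^sup>2)) sequentially"
  proof -
    have "eventually (\<lambda>n::nat. 1 / s < real n) sequentially"
      using filterlim_real_sequentially by (simp add: filterlim_at_top_dense)
    with nat_ceiling_in_middle_ranks[OF p] alpha_pos show ?thesis
    proof eventually_elim
      case (elim n)
      have i_mid: "i n \<in> middle_ranks n" using elim by (simp add: i_def)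
      hence i: "1 \<le> i n" "i n \<le> n" using middle_ranks_subset[of n] elim by force+
      have fin: "finite (middle_ranks n)" using middle_ranks_subset[of n] elim finite_subset by blast
      have n: "0 < real n" using i by linarith
      have "real n * p \<le> real (i n)" "real (i n) < real n * p + 1"
        using p n by (simp_all add: i_def) (linarith | simp add: ceiling_less_iff)+
      hence ip: "p \<le> real (i n) / real n" "real (i n) / real n \<le> p + s"
        using n elim s by (auto simp: field_simps)
      note [measurable] = measurable_order_stat[OF i] iid_seq_measurable[OF A] iid_seq_measurable[OF B]
      have [measurable]: "max_ratio A B n \<in> borel_measurable M"
        using measurable_max_ratio[OF A B] elim i_mid by blast
      define N1 where "N1 = {\<omega>\<in>space M. \<bar>max_ratio A B n \<omega> - 1\<bar> > \<epsilon>}"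
      define N2 where "N2 = {\<omega>\<in>space M. order_stat A n (i n) \<omega> \<le> u}"
      define N3 where "N3 = {\<omega>\<in>space M. t < order_stat B n (i n) \<omega>}"
      define N4 where "N4 = {\<omega>\<in>space M. order_stat B n (i n) \<omega> \<le> 0}"
      have [measurable]: "N1 \<in> events" "N2 \<in> events" "N3 \<in> events" "N4 \<in> events"
        unfolding N1_def N2_def N3_def N4_def by measurable
      have "space M \<subseteq> N1 \<union> N2 \<union> N3 \<union> N4"
      proof (rule subsetI, rule ccontr)
        fix \<omega> assume \<omega>: "\<omega> \<in> space M" "\<omega> \<notin> N1 \<union> N2 \<union> N3 \<union> N4"
        let ?a = "order_stat A n (i n) \<omega>" and ?b = "order_stat B n (i n) \<omega>"
        have b: "0 < ?b" "?b \<le> t" and a: "u < ?a" and m: "max_ratio A B n \<omega> \<le> 1 + \<epsilon>"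
          using \<omega> by (auto simp: N1_def N2_def N3_def N4_def)
        have "?a / ?b \<le> max_ratio A B n \<omega>"
          unfolding max_ratio_def using fin i_mid by (intro Max_ge) auto
        also have "\<dots> \<le> u / t" using m by (simp add: \<epsilon>_def)
        also have "\<dots> \<le> u / ?b" using b t tu by (intro divide_left_mono) auto
        finally show False using a b by (simp add: divide_le_cancel)
      qed
      hence "prob (space M) \<le> prob (N1 \<union> N2 \<union> N3 \<union> N4)" by (intro finite_measure_mono) auto
      also have "\<dots> \<le> prob N1 + prob N2 + prob N3 + prob N4"
        by (intro order_trans[OF measure_Un_le] add_mono order_refl) measurable
      finally have "1 \<le> prob N1 + prob N2 + prob N3 + prob N4" by (simp add: prob_space)
      moreover have "prob N2 \<le> exp (- 2 * real n * s\<^sup>2)"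
        unfolding N2_def using s ps ip by (intro prob_order_stat_le[OF A i]) auto
      moreover have "prob N3 \<le> exp (- 2 * real n * s\<^sup>2)"
        unfolding N3_def using s ps ip by (intro prob_order_stat_gt[OF B i]) auto
      moreover have "prob N4 \<le> exp (- 2 * real n * p\<^sup>2)"
        unfolding N4_def using p ip E0 by (intro prob_order_stat_le[OF B i]) auto
      ultimately show ?case by (simp add: P_def N1_def)
    qed
  qed
  moreover have "(\<lambda>n. P n + 2 * exp (- 2 * real n * s\<^sup>2) + exp (- 2 * real n * p\<^sup>2)) \<longlonglongrightarrow> 0 + 2 * 0 + 0"
    using s p by (intro tendsto_intros P) real_asymp+
  ultimately have "1 \<le> (0 + 2 * 0 + 0 :: real)"
    by (intro tendsto_lowerbound[OF _ _ trivial_limit_sequentially]) assumption+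
  thus False by simp
qed

lemma cdf_mono_if_max_ratio_conv:
  assumes A: "iid_seq A D" and B: "iid_seq B E" and E0: "cdf E 0 = 0"
    and conv: "conv_in_prob (max_ratio A B) 1"
  shows "cdf E t \<le> cdf D t"
proof -
  interpret D: real_distribution D using A by (rule iid_seq_real_distribution)
  have "(cdf D \<longlongrightarrow> cdf D t) (at_right t)"
    using D.cdf_is_right_cont[of t] by (simp add: continuous_within)
  moreover have "eventually (\<lambda>u. cdf E t \<le> cdf D u) (at_right t)"
    using eventually_at_right_less[of t]
    by eventually_elim (rule cdf_le_if_max_ratio_conv[OF assms])
  ultimately show ?thesis by (rule tendsto_lowerbound) simp
qed

end

section \<open>Exponential samples\<close>

text \<open>With \<open>Q(u) = - ln (1 - u)\<close> this compares \<open>Q(p + \<delta>)\<close> with \<open>Q(p - \<delta>)\<close>. Their difference is the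
  logarithm of \<open>1 + 2\<delta> / (1 - p - \<delta>)\<close>, hence of order \<open>\<delta> / (1 - p)\<close>, while \<open>Q(p - \<delta>)\<close> is at least
  of order \<open>p\<close>. So the relative error is of order \<open>\<delta> / (p (1 - p))\<close>, and this is where closeness to
  either end of the unit interval must be excluded: \<open>p (1 - p)\<close> is at least half the smaller of \<open>p\<close>
  and \<open>1 - p\<close>.\<close>

lemma exponential_quantile_ratio:
  fixes p \<delta> \<eta> :: real
  assumes \<eta>: "0 < \<eta>" "\<eta> < 1" and p: "\<delta> \<le> \<eta> * p" "\<delta> \<le> \<eta> * (1 - p)" and "0 < \<delta>"
  shows "- ln (1 - (p + \<delta>)) \<le> (1 + 4 * \<eta> / (1 - \<eta>)\<^sup>2) * - ln (1 - (p - \<delta>))"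
proof -
  have pos: "0 < p" "0 < 1 - p" using p assms by (auto simp: zero_less_mult_iff dest: less_le_trans)
  have "\<delta> \<le> 2 * \<eta> * (p * (1 - p))"
  proof (cases "p \<le> 1 / 2")
    case True
    hence "\<eta> * p * 1 \<le> \<eta> * p * (2 * (1 - p))" using \<eta> pos by (intro mult_left_mono) auto
    thus ?thesis using p by (simp add: algebra_simps)
  next
    case False
    hence "\<eta> * (1 - p) * 1 \<le> \<eta> * (1 - p) * (2 * p)" using \<eta> pos by (intro mult_left_mono) auto
    thus ?thesis using p by (simp add: algebra_simps)
  qed
  note \<delta> = this
  define a where "a = 1 - p - \<delta>"
  have a: "(1 - \<eta>) * (1 - p) \<le> a" using p by (simp add: a_def algebra_simps)
  have a0: "0 < (1 - \<eta>) * (1 - p)" using \<eta> pos by simp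
  have b: "(1 - \<eta>) * p \<le> p - \<delta>" using p by (simp add: algebra_simps)
  have b0: "0 < (1 - \<eta>) * p" using \<eta> pos by simp
  have "p - \<delta> \<le> - ln (1 - (p - \<delta>))"
    using ln_le_minus_one[of "1 - (p - \<delta>)"] a a0 assms by (simp add: a_def)
  hence Q: "(1 - \<eta>) * p \<le> - ln (1 - (p - \<delta>))" using b by simp
  have "ln (1 - (p - \<delta>)) - ln (1 - (p + \<delta>)) = ln (1 + 2 * \<delta> / a)"
  proof -
    have "0 < a" using a a0 by linarith
    hence "ln (a + 2 * \<delta>) - ln a = ln ((a + 2 * \<delta>) / a)"
      using \<open>0 < \<delta>\<close> by (simp add: ln_div)
    moreover have "1 - (p - \<delta>) = a + 2 * \<delta>" "1 - (p + \<delta>) = a"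
      by (simp_all add: a_def)
    moreover have "(a + 2 * \<delta>) / a = 1 + 2 * \<delta> / a" using \<open>0 < a\<close> by (simp add: add_divide_distrib)
    ultimately show ?thesis by (simp only:)
  qed
  also have "\<dots> \<le> 2 * \<delta> / a" using a a0 assms by (intro ln_add_one_self_le_self) auto
  also have "\<dots> \<le> 2 * (2 * \<eta> * (p * (1 - p))) / ((1 - \<eta>) * (1 - p))"
    using a a0 \<delta> assms by (intro frac_le) auto
  also have "\<dots> = 4 * \<eta> / (1 - \<eta>)\<^sup>2 * ((1 - \<eta>) * p)"
  proof -
    have "2 * (2 * \<eta> * (p * f)) / (e * f) = 4 * \<eta> / e\<^sup>2 * (e * p)"
      if "0 < e" "0 < f" for e f :: real
      using that by (simp add: field_simps power2_eq_square)
    from this[of "1 - \<eta>" "1 - p"] show ?thesis using \<eta> pos by simp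
  qed
  also have "\<dots> \<le> 4 * \<eta> / (1 - \<eta>)\<^sup>2 * - ln (1 - (p - \<delta>))"
    using Q \<eta> by (intro mult_left_mono) auto
  finally show ?thesis by (simp add: algebra_simps)
qed

lemma cdf_unit_exponential_quantile:
  assumes "0 \<le> q" "q < 1"
  shows "cdf unit_exponential (- ln (1 - q)) = q"
  using assms by (subst cdf_unit_exponential) (auto simp: ln_le_zero_iff)

lemma ratio_near_1:
  fixes x y a b \<epsilon> :: real
  assumes "0 < a" "b \<le> (1 + \<epsilon>) * a" "0 \<le> \<epsilon>" "a < x" "x \<le> b" "a < y" "y \<le> b"
  shows "\<bar>x / y - 1\<bar> \<le> \<epsilon>"
proof -
  have *: "v \<le> (1 + \<epsilon>) * w" if "v \<le> b" "a < w" for v w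
  proof -
    have "(1 + \<epsilon>) * a \<le> (1 + \<epsilon>) * w" using that assms by (intro mult_left_mono) auto
    thus ?thesis using that assms by linarith
  qed
  have "x \<le> (1 + \<epsilon>) * y" using * assms by blast
  moreover have "(1 - \<epsilon>) * y \<le> x"
  proof (cases "\<epsilon> \<le> 1")
    case True
    have "(1 - \<epsilon>) * y \<le> (1 - \<epsilon>) * ((1 + \<epsilon>) * x)" using True * assms by (intro mult_left_mono) auto
    also have "\<dots> = x - \<epsilon>\<^sup>2 * x" by (simp add: algebra_simps power2_eq_square)
    also have "\<dots> \<le> x" using assms by simp
    finally show ?thesis .
  next
    case False
    hence "(1 - \<epsilon>) * y \<le> 0" using assms by (intro mult_nonpos_nonneg) auto
    thus ?thesis using assms by linarith
  qed
  ultimately show ?thesis using assms by (simp add: abs_le_iff field_simps)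
qed

context prob_space
begin

text \<open>A union bound over the ranks makes the quantile brackets hold simultaneously.\<close>

lemma prob_order_stat_outside_exponential_quantiles:
  assumes Z: "iid_seq Z unit_exponential" and I: "I \<subseteq> {1..n}" and "0 \<le> \<delta>"
    and \<delta>: "\<And>i. i \<in> I \<Longrightarrow> \<delta> \<le> real i / real n \<and> real i / real n + \<delta> < 1"
  defines "N \<equiv> \<Union>i\<in>I. {\<omega>\<in>space M. order_stat Z n i \<omega> \<le> - ln (1 - (real i / real n - \<delta>))} \<union>
                         {\<omega>\<in>space M. - ln (1 - (real i / real n + \<delta>)) < order_stat Z n i \<omega>}"
  shows "N \<in> events" "prob N \<le> 2 * real n * exp (- 2 * real n * \<delta>\<^sup>2)"
proof -
  define L where "L i = {\<omega>\<in>space M. order_stat Z n i \<omega> \<le> - ln (1 - (real i / real n - \<delta>))}" for i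
  define R where "R i = {\<omega>\<in>space M. - ln (1 - (real i / real n + \<delta>)) < order_stat Z n i \<omega>}" for i
  have N: "N = (\<Union>i\<in>I. L i \<union> R i)" by (simp add: N_def L_def R_def)
  have fin: "finite I" using I finite_subset by blast
  have I_D: "1 \<le> i" "i \<le> n" if "i \<in> I" for i using that I by auto
  have ev: "L i \<in> events" "R i \<in> events" if "i \<in> I" for i
  proof -
    note [measurable] = measurable_order_stat[OF I_D[OF that]] iid_seq_measurable[OF Z]
    show "L i \<in> events" "R i \<in> events" unfolding L_def R_def by measurable
  qed
  show "N \<in> events" unfolding N using fin ev by auto
  have "prob N \<le> (\<Sum>i\<in>I. prob (L i \<union> R i))"
    unfolding N using fin ev by (intro finite_measure_subadditive_finite) auto
  also have "\<dots> \<le> (\<Sum>i\<in>I. 2 * exp (- 2 * real n * \<delta>\<^sup>2))"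
  proof (rule sum_mono)
    fix i assume i: "i \<in> I"
    have "prob (L i) \<le> exp (- 2 * real n * \<delta>\<^sup>2)"
      unfolding L_def using \<delta>[OF i] assms(3)
      by (intro prob_order_stat_le[OF Z I_D[OF i]]) (auto simp: cdf_unit_exponential_quantile)
    moreover have "prob (R i) \<le> exp (- 2 * real n * \<delta>\<^sup>2)"
      unfolding R_def using \<delta>[OF i] assms(3)
      by (intro prob_order_stat_gt[OF Z I_D[OF i]]) (auto simp: cdf_unit_exponential_quantile)
    ultimately show "prob (L i \<union> R i) \<le> 2 * exp (- 2 * real n * \<delta>\<^sup>2)"
      using measure_Un_le[OF ev[OF i]] by linarith
  qed
  also have "\<dots> = real (card I) * (2 * exp (- 2 * real n * \<delta>\<^sup>2))" by simp
  also have "\<dots> \<le> real n * (2 * exp (- 2 * real n * \<delta>\<^sup>2))"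
    using card_mono[OF _ I] by (intro mult_right_mono) auto
  finally show "prob N \<le> 2 * real n * exp (- 2 * real n * \<delta>\<^sup>2)" by simp
qed

lemma exponential_max_ratio_conv:
  assumes A: "iid_seq A unit_exponential" and B: "iid_seq B unit_exponential"
  shows "conv_in_prob (max_ratio A B) 1"
  unfolding conv_in_prob_def
proof (intro allI impI)
  fix \<epsilon> :: real assume \<epsilon>: "0 < \<epsilon>"
  \<comment> \<open>For \<open>\<eta> \<le> 1 / 2\<close> the relative error \<open>4 \<eta> / (1 - \<eta>)\<^sup>2\<close> of the quantiles is at most \<open>16 \<eta>\<close>.\<close>
  define \<eta> where "\<eta> = min (1 / 2) (\<epsilon> / 16)"
  have \<eta>: "0 < \<eta>" "\<eta> \<le> 1 / 2" "16 * \<eta> \<le> \<epsilon>" using \<epsilon> by (auto simp: \<eta>_def)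
  have "(1 / 2)\<^sup>2 \<le> (1 - \<eta>)\<^sup>2" using \<eta> by (intro power_mono) auto
  hence "4 * \<eta> / (1 - \<eta>)\<^sup>2 \<le> 4 * \<eta> / (1 / 2)\<^sup>2" using \<eta> by (intro frac_le) auto
  also have "\<dots> \<le> \<epsilon>" using \<eta> by (simp add: power2_eq_square)
  finally have \<eta>\<epsilon>: "4 * \<eta> / (1 - \<eta>)\<^sup>2 \<le> \<epsilon>" .
  define \<delta> where "\<delta> n = sqrt (ln (real n) / real n)" for n
  have bound: "eventually (\<lambda>n. prob {\<omega>\<in>space M. \<bar>max_ratio A B n \<omega> - 1\<bar> > \<epsilon>} \<le> 4 / real n) sequentially"
    using sqrt_ln_div_le_alpha[OF \<eta>(1)] alpha_pos middle_ranks_nonempty eventually_gt_at_top[of 1]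
  proof eventually_elim
    case (elim n)
    have n: "0 < real n" "0 < ln (real n)" using elim by auto
    have \<delta>0: "0 < \<delta> n" using n by (simp add: \<delta>_def)
    have \<delta>2: "real n * (\<delta> n)\<^sup>2 = ln (real n)" using n by (simp add: \<delta>_def)
    have sub: "middle_ranks n \<subseteq> {1..n}" using middle_ranks_subset[of n] elim by auto
    have fin: "finite (middle_ranks n)" using sub finite_subset by blast
    have *: "\<delta> n \<le> \<eta> * (real i / real n)" "\<delta> n \<le> \<eta> * (1 - real i / real n)"
      if "i \<in> middle_ranks n" for i
    proof -
      have "alpha n \<le> real i / real n" "alpha n \<le> 1 - real i / real n"
        using that n by (auto simp: middle_ranks_def beta_def field_simps)
      hence "\<eta> * alpha n \<le> \<eta> * (real i / real n)" "\<eta> * alpha n \<le> \<eta> * (1 - real i / real n)"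
        using \<eta> by (simp_all only: mult_le_cancel_left_pos)
      thus "\<delta> n \<le> \<eta> * (real i / real n)" "\<delta> n \<le> \<eta> * (1 - real i / real n)"
        using elim by (auto simp: \<delta>_def)
    qed
    have in_range: "\<delta> n < real i / real n \<and> real i / real n + \<delta> n < 1" if "i \<in> middle_ranks n" for i
    proof -
      have "0 < \<eta> * (real i / real n)" "0 < \<eta> * (1 - real i / real n)"
        using *[OF that] \<delta>0 by linarith+
      hence pos: "0 < real i / real n" "0 < 1 - real i / real n"
        using \<eta>(1) by (blast intro: zero_less_mult_pos)+
      have "\<delta> n < 1 * (real i / real n)"
        by (rule le_less_trans[OF *(1)[OF that] mult_strict_right_mono]) (use \<eta> pos in auto)
      moreover have "\<delta> n < 1 * (1 - real i / real n)"
        by (rule le_less_trans[OF *(2)[OF that] mult_strict_right_mono]) (use \<eta> pos in auto)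
      ultimately show ?thesis by auto
    qed
    define N where "N Z = (\<Union>i\<in>middle_ranks n.
        {\<omega>\<in>space M. order_stat Z n i \<omega> \<le> - ln (1 - (real i / real n - \<delta> n))} \<union>
        {\<omega>\<in>space M. - ln (1 - (real i / real n + \<delta> n)) < order_stat Z n i \<omega>})" for Z :: "nat \<Rightarrow> 'a \<Rightarrow> real"
    have N: "N Z \<in> events" "prob (N Z) \<le> 2 / real n" if Z: "iid_seq Z unit_exponential" for Z
    proof -
      have "\<delta> n \<le> real i / real n \<and> real i / real n + \<delta> n < 1" if "i \<in> middle_ranks n" for i
        using in_range[OF that] by simp
      note outside = prob_order_stat_outside_exponential_quantiles[OF Z sub less_imp_le[OF \<delta>0] this, folded N_def]
      show "N Z \<in> events" by (rule outside)
      have "- 2 * real n * (\<delta> n)\<^sup>2 = - 2 * ln (real n)" using \<delta>2 by (simp add: mult.assoc)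
      also have "\<dots> = ln (1 / (real n)\<^sup>2)" using n by (simp add: ln_div ln_realpow)
      finally have "2 * real n * exp (- 2 * real n * (\<delta> n)\<^sup>2) = 2 / real n"
        using n by (simp add: power2_eq_square)
      thus "prob (N Z) \<le> 2 / real n" using outside(2) by simp
    qed
    have "{\<omega>\<in>space M. \<bar>max_ratio A B n \<omega> - 1\<bar> > \<epsilon>} \<subseteq> N A \<union> N B"
    proof safe
      fix \<omega> assume \<omega>: "\<omega> \<in> space M" "\<bar>max_ratio A B n \<omega> - 1\<bar> > \<epsilon>" "\<omega> \<notin> N B"
      show "\<omega> \<in> N A"
      proof (rule ccontr)
        assume "\<omega> \<notin> N A"
        have near: "\<bar>order_stat A n i \<omega> / order_stat B n i \<omega> - 1\<bar> \<le> \<epsilon>" if i: "i \<in> middle_ranks n" for i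
        proof (rule ratio_near_1)
          let ?p = "real i / real n"
          show "0 < - ln (1 - (?p - \<delta> n))"
            using in_range[OF i] \<delta>0 by simp
          have "- ln (1 - (?p + \<delta> n)) \<le> (1 + 4 * \<eta> / (1 - \<eta>)\<^sup>2) * - ln (1 - (?p - \<delta> n))"
            using *[OF i] \<delta>0 \<eta> by (intro exponential_quantile_ratio) auto
          also have "\<dots> \<le> (1 + \<epsilon>) * - ln (1 - (?p - \<delta> n))"
            using \<eta>\<epsilon> \<open>0 < - ln (1 - (?p - \<delta> n))\<close> by (intro mult_right_mono) auto
          finally show "- ln (1 - (?p + \<delta> n)) \<le> (1 + \<epsilon>) * - ln (1 - (?p - \<delta> n))" .
        qed (use \<epsilon> \<omega> \<open>\<omega> \<notin> N A\<close> i in \<open>auto simp: N_def not_le not_less\<close>)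
        have "max_ratio A B n \<omega> \<in> (\<lambda>i. order_stat A n i \<omega> / order_stat B n i \<omega>) ` middle_ranks n"
          unfolding max_ratio_def using fin elim by (intro Max_in) auto
        thus False using near \<omega> by force
      qed
    qed
    hence "prob {\<omega>\<in>space M. \<bar>max_ratio A B n \<omega> - 1\<bar> > \<epsilon>} \<le> prob (N A \<union> N B)"
      using N(1)[OF A] N(1)[OF B] by (intro finite_measure_mono) auto
    also have "\<dots> \<le> prob (N A) + prob (N B)"
      using N(1)[OF A] N(1)[OF B] by (intro measure_Un_le)
    also have "\<dots> \<le> 4 / real n" using N(2)[OF A] N(2)[OF B] by simp
    finally show ?case .
  qed
  show "(\<lambda>n. prob {\<omega>\<in>space M. \<bar>max_ratio A B n \<omega> - 1\<bar> > \<epsilon>}) \<longlonglongrightarrow> 0"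
  proof (rule tendsto_sandwich[where f = "\<lambda>_. 0", OF _ bound])
    show "(\<lambda>n. 4 / real n) \<longlonglongrightarrow> 0" by real_asymp
  qed auto
qed

end

section \<open>The characterisation\<close>

theorem theorem2p6:
  fixes M :: "'a measure" and X Y :: "nat \<Rightarrow> 'a \<Rightarrow> real" and D :: "real measure"
  assumes "prob_space M"
    and "prob_space.iid_seq M X unit_exponential"
    and "prob_space.iid_seq M Y D"
    and "prob_space.indep_seqs M X Y"
    and "\<And>i. AE \<omega> in M. 0 < Y i \<omega>"
    and "continuous_on UNIV (cdf D)"
    and "strict_mono_on (measure_support D \<inter> {0<..}) (cdf D)"
  shows "(prob_space.conv_in_prob M (max_ratio X Y) 1 \<and> prob_space.conv_in_prob M (max_ratio Y X) 1)
     \<longleftrightarrow> D = unit_exponential"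
proof -
  interpret prob_space M by fact
  note X = assms(2) and Y = assms(3)
  have X0: "cdf unit_exponential 0 = 0" using cdf_unit_exponential[of 0] by simp
  have "cdf D 0 = prob {\<omega>\<in>space M. Y 0 \<omega> \<le> 0}" by (rule iid_seq_cdf[OF Y])
  also have "\<dots> = prob {}"
    using assms(5)[of 0] iid_seq_measurable[OF Y, of 0] by (intro measure_eq_AE) auto
  finally have Y0: "cdf D 0 = 0" by simp
  show ?thesis
  proof
    assume conv: "conv_in_prob (max_ratio X Y) 1 \<and> conv_in_prob (max_ratio Y X) 1"
    have "cdf D = cdf unit_exponential"
      using cdf_mono_if_max_ratio_conv[OF X Y Y0] cdf_mono_if_max_ratio_conv[OF Y X X0] conv
      by (intro ext antisym) auto
    thus "D = unit_exponential"
      by (rule cdf_unique[OF iid_seq_real_distribution[OF Y] iid_seq_real_distribution[OF X]])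
  next
    assume "D = unit_exponential"
    thus "conv_in_prob (max_ratio X Y) 1 \<and> conv_in_prob (max_ratio Y X) 1"
      using X Y by (auto intro: exponential_max_ratio_conv)
  qed
qed

end
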